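(* An $\varepsilon$-approximately $k$-submodular function need not be $\varepsilon$-approximately diminishing returns: there exist $\varepsilon>0$, a finite set $V$, an integer $k\ge1$ and a function $F:(k+1)^V\to\mathbb{R}_{\ge0}$ that is $\varepsilon$-approximately $k$-submodular but not $\varepsilon$-approximately diminishing returns.
   Context: $(k+1)^V$ denotes the set of $k$-tuples $\mathbf{x}=(X_1,\dots,X_k)$ of pairwise disjoint subsets of $V$; $\mathbf{0}=(\emptyset,\dots,\emptyset)$; $\mathrm{supp}(\mathbf{x})=\bigcup_iX_i$; $\mathbf{x}\preceq\mathbf{y}$ means $X_i\subseteq Y_i$ for all $i$. For $g:(k+1)^V\to\mathbb{R}$, $u\notin\mathrm{supp}(\mathbf{x})$, $i\in[k]$: $\Delta_{u,i}g(\mathbf{x})=g(X_1,\dots,X_i\cup\{u\},\dots,X_k)-g(\mathbf{x})$. $f$ is $k$-submodular if (a) $\Delta_{u,i}f(\mathbf{x})\ge\Delta_{u,i}f(\mathbf{y})$ whenever $\mathbf{x}\preceq\mathbf{y}$, $u\notin\mathrm{supp}(\mathbf{y})$, and (b) $\Delta_{u,i}f(\mathbf{x})+\Delta_{u,j}f(\mathbf{x})\ge0$ for $i\ne j$; monotone if $\mathbf{x}\preceq\mathbf{y}\Rightarrow f(\mathbf{x})\le f(\mathbf{y})$; functions are normalized with value $0$ at $\mathbf{0}$. $F$ is $\varepsilon$-approximately $k$-submodular if there is a monotone $k$-submodular $f$ with $(1-\varepsilon)f(\mathbf{x})\le F(\mathbf{x})\le(1+\varepsilon)f(\mathbf{x})$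 for all $\mathbf{x}$; $F$ is $\varepsilon$-approximately diminishing returns if there is a monotone $k$-submodular $f$ with $(1-\varepsilon)\Delta_{u,i}f(\mathbf{x})\le\Delta_{u,i}F(\mathbf{x})\le(1+\varepsilon)\Delta_{u,i}f(\mathbf{x})$ for all $\mathbf{x}$, $u\notin\mathrm{supp}(\mathbf{x})$, $i\in[k]$. *)

theory Defs
  imports Complex_Main "HOL-Library.FuncSet" "HOL-Library.Disjoint_Sets"
begin

(* A k-tuple (X_1, ..., X_k) is a function on {1..k} in the sense of PiE, i.e. with the value
   undefined outside {1..k}, so that equal tuples are equal functions. *)

definition ktuples :: "nat \<Rightarrow> 'a set \<Rightarrow> (nat \<Rightarrow> 'a set) set" where
  "ktuples k V = {X \<in> {1..k} \<rightarrow>\<^sub>E Pow V. disjoint_family_on X {1..k}}"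

definition kzero :: "nat \<Rightarrow> nat \<Rightarrow> 'a set" where
  "kzero k = (\<lambda>i\<in>{1..k}. {})"

definition ksupp :: "nat \<Rightarrow> (nat \<Rightarrow> 'a set) \<Rightarrow> 'a set" where
  "ksupp k X = (\<Union>i\<in>{1..k}. X i)"

definition kle :: "nat \<Rightarrow> (nat \<Rightarrow> 'a set) \<Rightarrow> (nat \<Rightarrow> 'a set) \<Rightarrow> bool" where
  "kle k X Y \<longleftrightarrow> (\<forall>i\<in>{1..k}. X i \<subseteq> Y i)"

definition marginal ::
  "((nat \<Rightarrow> 'a set) \<Rightarrow> real) \<Rightarrow> 'a \<Rightarrow> nat \<Rightarrow> (nat \<Rightarrow> 'a set) \<Rightarrow> real" where
  "marginal g u i X = g (X(i := X i \<union> {u})) - g X"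

(* Every property below constrains a function only on ktuples k V; its values elsewhere
   are irrelevant. *)

definition knormalized :: "nat \<Rightarrow> ((nat \<Rightarrow> 'a set) \<Rightarrow> real) \<Rightarrow> bool" where
  "knormalized k g \<longleftrightarrow> g (kzero k) = 0"

definition kmonotone :: "nat \<Rightarrow> 'a set \<Rightarrow> ((nat \<Rightarrow> 'a set) \<Rightarrow> real) \<Rightarrow> bool" where
  "kmonotone k V f \<longleftrightarrow>
     (\<forall>X\<in>ktuples k V. \<forall>Y\<in>ktuples k V. kle k X Y \<longrightarrow> f X \<le> f Y)"

definition ksubmodular :: "nat \<Rightarrow> 'a set \<Rightarrow> ((nat \<Rightarrow> 'a set) \<Rightarrow> real) \<Rightarrow> bool" where
  "ksubmodular k V f \<longleftrightarrow>
     (\<forall>X\<in>ktuples k V. \<forall>Y\<in>ktuples k V. kle k X Y \<longrightarrow>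
        (\<forall>u\<in>V - ksupp k Y. \<forall>i\<in>{1..k}. marginal f u i X \<ge> marginal f u i Y)) \<and>
     (\<forall>X\<in>ktuples k V. \<forall>u\<in>V - ksupp k X. \<forall>i\<in>{1..k}. \<forall>j\<in>{1..k}.
        i \<noteq> j \<longrightarrow> marginal f u i X + marginal f u j X \<ge> 0)"

definition approx_ksubmodular ::
  "real \<Rightarrow> nat \<Rightarrow> 'a set \<Rightarrow> ((nat \<Rightarrow> 'a set) \<Rightarrow> real) \<Rightarrow> bool" where
  "approx_ksubmodular \<epsilon> k V F \<longleftrightarrow>
     (\<exists>f. knormalized k f \<and> kmonotone k V f \<and> ksubmodular k V f \<and>
        (\<forall>X\<in>ktuples k V. (1 - \<epsilon>) * f X \<le> F X \<and> F X \<le> (1 + \<epsilon>) * f X))"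

definition approx_diminishing_returns ::
  "real \<Rightarrow> nat \<Rightarrow> 'a set \<Rightarrow> ((nat \<Rightarrow> 'a set) \<Rightarrow> real) \<Rightarrow> bool" where
  "approx_diminishing_returns \<epsilon> k V F \<longleftrightarrow>
     (\<exists>f. knormalized k f \<and> kmonotone k V f \<and> ksubmodular k V f \<and>
        (\<forall>X\<in>ktuples k V. \<forall>u\<in>V - ksupp k X. \<forall>i\<in>{1..k}.
           (1 - \<epsilon>) * marginal f u i X \<le> marginal F u i X \<and>
           marginal F u i X \<le> (1 + \<epsilon>) * marginal f u i X))"

lemma kzero_in_ktuples: "kzero k \<in> ktuples k V"
  by (auto simp: kzero_def ktuples_def disjoint_family_on_def)

lemma update_in_ktuples:
  assumes "X \<in> ktuples k V" "u \<in> V - ksupp k X" "i \<in> {1..k}"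
  shows "X(i := X i \<union> {u}) \<in> ktuples k V"
proof -
  let ?Y = "X(i := X i \<union> {u})"
  have X: "X \<in> {1..k} \<rightarrow>\<^sub>E Pow V" and d: "disjoint_family_on X {1..k}"
    using assms(1) by (auto simp only: ktuples_def mem_Collect_eq)
  have u: "u \<in> V" "\<And>j. j \<in> {1..k} \<Longrightarrow> u \<notin> X j"
    using assms(2) unfolding ksupp_def by blast+
  have "X i \<union> {u} \<in> Pow V"
    using PiE_mem[OF X assms(3)] u(1) by blast
  then have "?Y \<in> insert i {1..k} \<rightarrow>\<^sub>E Pow V"
    using X by (rule PiE_fun_upd)
  then have 1: "?Y \<in> {1..k} \<rightarrow>\<^sub>E Pow V"
    using assms(3) by (simp only: insert_absorb)
  have "?Y m \<inter> ?Y n = {}" if "m \<in> {1..k}" "n \<in> {1..k}" "m \<noteq> n" for m n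
  proof -
    have "X m \<inter> X n = {}"
      using d that unfolding disjoint_family_on_def by blast
    then show ?thesis
      using u(2)[OF that(1)] u(2)[OF that(2)] that(3) by (cases "m = i"; cases "n = i") simp_all
  qed
  then have "disjoint_family_on ?Y {1..k}"
    unfolding disjoint_family_on_def by blast
  with 1 show ?thesis
    unfolding ktuples_def by blast
qed

end

theory Submission
  imports Defs
begin

text \<open>Relative closeness to a monotone function does not force monotonicity, whereas
  \<open>\<epsilon>\<close>-approximate diminishing returns does when \<open>\<epsilon> \<le> 1\<close>. So it suffices to perturb the indicator
  of nonemptiness (the case \<open>k = 1\<close>, two elements, \<open>\<epsilon> = 1/2\<close>) such that the full set has a smaller
  value than a singleton.\<close>

lemma kle_update: "kle k X (X(i := X i \<union> {u}))"
  by (auto simp: kle_def)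

text \<open>Monotonicity of the witness \<open>f\<close> makes its marginals nonnegative, and
  \<open>1 - \<epsilon>\<close> is nonnegative too, so the lower bound on the marginals of
  \<open>F\<close> is at least 0.\<close>

lemma approx_diminishing_returns_marginal_nonneg:
  assumes F: "approx_diminishing_returns \<epsilon> k V F" and "\<epsilon> \<le> 1"
    and X: "X \<in> ktuples k V" "u \<in> V - ksupp k X" "i \<in> {1..k}"
  shows "marginal F u i X \<ge> 0"
proof -
  obtain f where f: "kmonotone k V f"
    and bound: "\<forall>X\<in>ktuples k V. \<forall>u\<in>V - ksupp k X. \<forall>i\<in>{1..k}.
      (1 - \<epsilon>) * marginal f u i X \<le> marginal F u i X \<and>
      marginal F u i X \<le> (1 + \<epsilon>) * marginal f u i X"
    using F by (auto simp only: approx_diminishing_returns_def)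
  have "f X \<le> f (X(i := X i \<union> {u}))"
    using f[unfolded kmonotone_def, rule_format, OF X(1) update_in_ktuples[OF X] kle_update] .
  then have "0 \<le> (1 - \<epsilon>) * marginal f u i X"
    using \<open>\<epsilon> \<le> 1\<close> by (simp add: marginal_def)
  then show ?thesis
    using bound[rule_format, OF X] by linarith
qed

definition nonempty_indicator :: "(nat \<Rightarrow> 'a set) \<Rightarrow> real" where
  "nonempty_indicator X = of_bool (X 1 \<noteq> {})"

lemma knormalized_nonempty_indicator: "knormalized 1 nonempty_indicator"
  by (simp add: knormalized_def nonempty_indicator_def kzero_def)

lemma kmonotone_nonempty_indicator: "kmonotone 1 V nonempty_indicator"
  by (auto simp: kmonotone_def nonempty_indicator_def kle_def)

text \<open>A new element gains 1 over the empty set and 0 over any other set, so marginals only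
  shrink. The pairwise condition is vacuous, since there is a single index.\<close>

lemma ksubmodular_nonempty_indicator: "ksubmodular 1 V nonempty_indicator"
  by (auto simp: ksubmodular_def nonempty_indicator_def kle_def marginal_def)

text \<open>The value 1/2 is the smallest that closeness to the indicator with
  \<open>\<epsilon> = 1/2\<close> permits on a nonempty set.\<close>

definition dipped_indicator :: "(nat \<Rightarrow> nat set) \<Rightarrow> real" where
  "dipped_indicator X = (if X 1 = {0, 1} then 1 / 2 else nonempty_indicator X)"

lemma dipped_indicator_nonneg: "dipped_indicator X \<ge> 0"
  by (simp add: dipped_indicator_def nonempty_indicator_def)

lemma knormalized_dipped_indicator: "knormalized 1 dipped_indicator"
  by (simp add: knormalized_def dipped_indicator_def nonempty_indicator_def kzero_def)

lemma approx_ksubmodular_dipped_indicator: "approx_ksubmodular (1 / 2) 1 V dipped_indicator"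
  unfolding approx_ksubmodular_def
proof (intro exI conjI ballI)
  fix X :: "nat \<Rightarrow> nat set"
  show "(1 - 1 / 2) * nonempty_indicator X \<le> dipped_indicator X"
    and "dipped_indicator X \<le> (1 + 1 / 2) * nonempty_indicator X"
    by (auto simp: dipped_indicator_def nonempty_indicator_def)
qed (rule knormalized_nonempty_indicator kmonotone_nonempty_indicator
    ksubmodular_nonempty_indicator)+

lemma not_approx_diminishing_returns_dipped_indicator:
  assumes "\<epsilon> \<le> 1"
  shows "\<not> approx_diminishing_returns \<epsilon> 1 {0, 1} dipped_indicator"
proof
  \<comment> \<open>The singleton {0}, written as an update of the zero tuple so that
    \<open>update_in_ktuples\<close> applies. Adding the element 1 to it lowers the value from 1 to
    1/2, a marginal of -1/2.\<close>
  let ?X = "(kzero 1)(1 := kzero 1 1 \<union> {0 :: nat})"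
  assume F: "approx_diminishing_returns \<epsilon> 1 {0, 1} dipped_indicator"
  have X: "?X \<in> ktuples 1 {0, 1}"
    by (rule update_in_ktuples[OF kzero_in_ktuples]) (auto simp: ksupp_def kzero_def)
  have "1 \<in> {0, 1} - ksupp 1 ?X"
    by (simp add: ksupp_def kzero_def)
  then have "marginal dipped_indicator 1 1 ?X \<ge> 0"
    by (rule approx_diminishing_returns_marginal_nonneg[OF F assms X]) simp
  moreover have "dipped_indicator ?X = 1"
    by (auto simp: dipped_indicator_def nonempty_indicator_def kzero_def)
  moreover have "(?X(1 := ?X 1 \<union> {1})) 1 = {0, 1}"
    by (auto simp: kzero_def)
  then have "dipped_indicator (?X(1 := ?X 1 \<union> {1})) = 1 / 2"
    unfolding dipped_indicator_def by (rule if_P)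
  ultimately show False
    unfolding marginal_def by linarith
qed

theorem theorem2:
  shows "\<exists>(\<epsilon>::real) (V::nat set) (k::nat) (F::(nat \<Rightarrow> nat set) \<Rightarrow> real).
    \<epsilon> > 0 \<and> finite V \<and> k \<ge> 1 \<and>
    (\<forall>X\<in>ktuples k V. F X \<ge> 0) \<and> knormalized k F \<and>
    approx_ksubmodular \<epsilon> k V F \<and> \<not> approx_diminishing_returns \<epsilon> k V F"
proof (intro exI conjI ballI)
  show "(1 / 2 :: real) > 0" "finite {0, 1 :: nat}" "(1 :: nat) \<ge> 1"
    by simp_all
  show "\<not> approx_diminishing_returns (1 / 2) 1 {0, 1} dipped_indicator"
    by (rule not_approx_diminishing_returns_dipped_indicator) simp
qed (rule dipped_indicator_nonneg knormalized_dipped_indicator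
    approx_ksubmodular_dipped_indicator)+

end
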